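(* Let $SN$ be a system net over the set of activities $\mathcal{U}_A$, let $\sigma_L \in \mathcal{U}_A^*$ be a log trace, and let $\sigma_M \in \phi_v(SN)$ be a visible firing sequence of $SN$. Then $$\delta_S(\gamma_{SN}(\sigma_L)) \leq \bigtriangleup(\sigma_L, \sigma_M),$$ where $\gamma_{SN}(\sigma_L)$ is an optimal alignment of $\sigma_L$ and $SN$ with respect to the standard cost function $\delta_S$, and $\bigtriangleup$ is the insertion/deletion edit distance.
   Context: $\mathcal{U}_A$ is the set (universe) of activities, and $\mathcal{U}_A^*$ is the set of finite sequences over it; a log trace is an element of $\mathcal{U}_A^*$. System nets. A labeled Petri net consists of a finite set of places $P$, a finite set of transitions $T$ disjoint from $P$, a flow relation $F \subseteq (P\times T)\cup(T\times P)$, and a labeling $l : T \to \mathcal{U}_A \cup \{\tau\}$, where $\tau \notin \mathcal{U}_A$; transitions $t$ with $l(t)=\tau$ are called silent (invisible), the others visible. Markings are multisets of places, with the usual firing rule: $t$ is enabled in marking $M$ if every input place of $t$ contains at least one token, and firing $t$ removes one token from each input place and adds one token to each output place. A system net $SN$ is a labeled Petri net together with an initial marking and a final marking. $\phi_f(SN) \subseteq T^*$ is the set of complete firing sequences, i.e., the sequences of transitions that can be fired successively from the initial marking and lead to the final marking. $\phi_v(SN) \subseteq \mathcal{U}_A^*$ is the set of visible traces, obtained from the sequences in $\phi_f(SN)$ by replacing each transition $t$ by its label $l(t)$ and deleting all occurrences of $\tau$. Alignments. Let $\gg$ be a fresh symbol. The set $A_{LM}$ of legal moves consists of: the synchronous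 moves $(x,t)$ with $x\in\mathcal{U}_A$, $t\in T$, $l(t)=x$; the moves in model only $(\gg,t)$ with $t\in T$; and the moves in log only $(x,\gg)$ with $x\in \mathcal{U}_A$. An alignment of $\sigma_L\in\mathcal{U}_A^*$ and $\sigma\in\phi_f(SN)$ is a sequence $\gamma\in A_{LM}^*$ whose projection on first components, ignoring $\gg$, is $\sigma_L$, and whose projection on second components, ignoring $\gg$, is $\sigma$. $\Gamma_{\sigma_L,SN}$ is the set of all $\gamma \in A_{LM}^*$ that are an alignment of $\sigma_L$ and some $\sigma\in\phi_f(SN)$. Standard cost. $\delta_S(x,t)=0$ for synchronous moves, $\delta_S(\gg,t)=0$ if $l(t)=\tau$, $\delta_S(\gg,t)=1$ if $l(t)\neq\tau$, and $\delta_S(x,\gg)=1$. The cost of an alignment $\gamma$ is the sum $\delta_S(\gamma)$ of the costs of its moves, counted with multiplicity. An alignment $\gamma\in\Gamma_{\sigma_L,SN}$ is optimal if $\delta_S(\gamma')\ge\delta_S(\gamma)$ for all $\gamma'\in\Gamma_{\sigma_L,SN}$. $\gamma_{SN}$ is a mapping assigning to each log trace $\sigma_L$ an optimal alignment $\gamma_{SN}(\sigma_L) \in \Gamma_{\sigma_L,SN}$. Edit distance. For finite sequences $\sigma,\sigma'$ over $\mathcal{U}_A$, $\bigtriangleup(\sigma,\sigma')\in\mathbb{N}$ is the minimum number of edits needed to transform $\sigma$ into $\sigma'$, where each edit is the deletion or the insertion of a single activity (no substitutions). *)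

theory Defs
  imports Main "HOL-Library.Multiset"
begin

text \<open>
  Places and transitions are disjoint sets of nodes of one type \<open>'n\<close>; the universe of activities
  is the type \<open>'a\<close>, and the silent label \<open>\<tau>\<close> is \<^const>\<open>None\<close>. The values of
  \<open>labeling\<close> outside \<open>transitions\<close> are irrelevant.
\<close>

record ('n, 'a) labeled_petri_net =
  places :: "'n set"
  transitions :: "'n set"
  flow :: "('n \<times> 'n) set"
  labeling :: "'n \<Rightarrow> 'a option"

record ('n, 'a) system_net = "('n, 'a) labeled_petri_net" +
  initial_marking :: "'n multiset"
  final_marking :: "'n multiset"

definition is_labeled_petri_net :: "('n, 'a, 'm) labeled_petri_net_scheme \<Rightarrow> bool" where
  "is_labeled_petri_net N \<longleftrightarrow>
     finite (places N) \<and> finite (transitions N) \<and> places N \<inter> transitions N = {} \<and>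
     flow N \<subseteq> (places N \<times> transitions N) \<union> (transitions N \<times> places N)"

definition is_system_net :: "('n, 'a) system_net \<Rightarrow> bool" where
  "is_system_net SN \<longleftrightarrow> is_labeled_petri_net SN \<and>
     set_mset (initial_marking SN) \<subseteq> places SN \<and> set_mset (final_marking SN) \<subseteq> places SN"

definition preset :: "('n, 'a, 'm) labeled_petri_net_scheme \<Rightarrow> 'n \<Rightarrow> 'n set" where
  "preset N t = {p. (p, t) \<in> flow N}"

definition postset :: "('n, 'a, 'm) labeled_petri_net_scheme \<Rightarrow> 'n \<Rightarrow> 'n set" where
  "postset N t = {p. (t, p) \<in> flow N}"

definition enabled :: "('n, 'a, 'm) labeled_petri_net_scheme \<Rightarrow> 'n multiset \<Rightarrow> 'n \<Rightarrow> bool" where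
  "enabled N M t \<longleftrightarrow> t \<in> transitions N \<and> (\<forall>p\<in>preset N t. p \<in># M)"

definition fire :: "('n, 'a, 'm) labeled_petri_net_scheme \<Rightarrow> 'n multiset \<Rightarrow> 'n \<Rightarrow> 'n multiset" where
  "fire N M t = M - mset_set (preset N t) + mset_set (postset N t)"

inductive firing_sequence ::
    "('n, 'a, 'm) labeled_petri_net_scheme \<Rightarrow> 'n multiset \<Rightarrow> 'n list \<Rightarrow> 'n multiset \<Rightarrow> bool"
  for N where
  "firing_sequence N M [] M"
| "enabled N M t \<Longrightarrow> firing_sequence N (fire N M t) ts M' \<Longrightarrow> firing_sequence N M (t # ts) M'"

definition complete_firing_sequences :: "('n, 'a) system_net \<Rightarrow> 'n list set" where
  "complete_firing_sequences SN =
     {ts. firing_sequence SN (initial_marking SN) ts (final_marking SN)}"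

text \<open>\<^const>\<open>List.map_filter\<close> applies the labeling and drops the transitions labeled \<^const>\<open>None\<close>.\<close>

definition visible_traces :: "('n, 'a) system_net \<Rightarrow> 'a list set" where
  "visible_traces SN = List.map_filter (labeling SN) ` complete_firing_sequences SN"

text \<open>In a move, \<^const>\<open>None\<close> in either component is the symbol \<open>\<ggreater>\<close>.\<close>

type_synonym ('n, 'a) move = "'a option \<times> 'n option"

definition legal_moves :: "('n, 'a, 'm) labeled_petri_net_scheme \<Rightarrow> ('n, 'a) move set" where
  "legal_moves N =
     {(Some x, Some t) | x t. t \<in> transitions N \<and> labeling N t = Some x} \<union>
     {(None, Some t) | t. t \<in> transitions N} \<union>
     {(Some x, None) | x. True}"

definition is_alignment ::
    "('n, 'a, 'm) labeled_petri_net_scheme \<Rightarrow> 'a list \<Rightarrow> 'n list \<Rightarrow> ('n, 'a) move list \<Rightarrow> bool" where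
  "is_alignment N \<sigma>\<^sub>L \<sigma> \<gamma> \<longleftrightarrow> \<gamma> \<in> lists (legal_moves N) \<and>
     List.map_filter fst \<gamma> = \<sigma>\<^sub>L \<and> List.map_filter snd \<gamma> = \<sigma>"

definition alignments :: "'a list \<Rightarrow> ('n, 'a) system_net \<Rightarrow> ('n, 'a) move list set" where
  "alignments \<sigma>\<^sub>L SN = {\<gamma>. \<exists>\<sigma>\<in>complete_firing_sequences SN. is_alignment SN \<sigma>\<^sub>L \<sigma> \<gamma>}"

text \<open>Only the values on legal moves matter.\<close>

fun standard_move_cost :: "('n, 'a, 'm) labeled_petri_net_scheme \<Rightarrow> ('n, 'a) move \<Rightarrow> nat" where
  "standard_move_cost N (Some x, Some t) = 0"
| "standard_move_cost N (None, Some t) = (if labeling N t = None then 0 else 1)"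
| "standard_move_cost N (Some x, None) = 1"
| "standard_move_cost N (None, None) = 0"

definition standard_cost :: "('n, 'a, 'm) labeled_petri_net_scheme \<Rightarrow> ('n, 'a) move list \<Rightarrow> nat" where
  "standard_cost N \<gamma> = sum_list (map (standard_move_cost N) \<gamma>)"

definition optimal_alignment :: "'a list \<Rightarrow> ('n, 'a) system_net \<Rightarrow> ('n, 'a) move list \<Rightarrow> bool" where
  "optimal_alignment \<sigma>\<^sub>L SN \<gamma> \<longleftrightarrow> \<gamma> \<in> alignments \<sigma>\<^sub>L SN \<and>
     (\<forall>\<gamma>'\<in>alignments \<sigma>\<^sub>L SN. standard_cost SN \<gamma>' \<ge> standard_cost SN \<gamma>)"

inductive edit :: "'a list \<Rightarrow> 'a list \<Rightarrow> bool" where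
  deletion: "edit (xs @ a # ys) (xs @ ys)"
| insertion: "edit (xs @ ys) (xs @ a # ys)"

definition edit_distance :: "'a list \<Rightarrow> 'a list \<Rightarrow> nat" where
  "edit_distance \<sigma> \<sigma>' = (LEAST n. (edit ^^ n) \<sigma> \<sigma>')"

text \<open>The set over which the minimum is taken is nonempty.\<close>

lemma edit_distance_attained: "(edit ^^ edit_distance \<sigma> \<sigma>') \<sigma> \<sigma>'"
proof -
  have del: "edit\<^sup>*\<^sup>* xs []" for xs :: "'a list"
  proof (induction xs)
    case (Cons x xs)
    have "edit (x # xs) xs" using edit.deletion[of "[]" x xs] by simp
    then show ?case using Cons by (rule converse_rtranclp_into_rtranclp)
  qed simp
  have ins: "edit\<^sup>*\<^sup>* [] xs" for xs :: "'a list"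
  proof (induction xs)
    case (Cons x xs)
    have "edit xs (x # xs)" using edit.insertion[of "[]" xs x] by simp
    with Cons show ?case by (rule rtranclp.rtrancl_into_rtrancl)
  qed simp
  have "edit\<^sup>*\<^sup>* \<sigma> \<sigma>'" using del ins by (rule rtranclp_trans)
  then obtain n where "(edit ^^ n) \<sigma> \<sigma>'" by (auto simp: rtranclp_power)
  then show ?thesis unfolding edit_distance_def by (rule LeastI)
qed

end

theory Submission
  imports Defs
begin

text \<open>
  Pairing each transition of a complete firing sequence with its own label gives an alignment of cost 0
  for the visible trace. Undoing one edit of the log trace changes a single move:
  a deleted activity becomes a move in log only, and an inserted activity either had such a move,
  which disappears, or a synchronous move, which becomes a move in model only. Hence each edit
  increases the cost by at most 1.
\<close>

lemma map_filter_append: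
  "List.map_filter f (xs @ ys) = List.map_filter f xs @ List.map_filter f ys"
  by (simp add: List.map_filter_def)

text \<open>Carries a split of the log trace over to the alignment. Elements that \<open>f\<close>
  drops at the boundary may lie on either side, so the statement leaves their place open.\<close>

lemma map_filter_eq_appendE:
  assumes "List.map_filter f zs = xs @ ys"
  obtains us vs where "zs = us @ vs" "List.map_filter f us = xs" "List.map_filter f vs = ys"
proof -
  have "\<exists>us vs. zs = us @ vs \<and> List.map_filter f us = xs \<and> List.map_filter f vs = ys"
    using assms
  proof (induction zs arbitrary: xs)
    case (Cons z zs)
    show ?case
    proof (cases "f z")
      case None
      with Cons obtain us vs where "zs = us @ vs" "List.map_filter f us = xs" "List.map_filter f vs = ys"
        by auto
      with None show ?thesis
        by (intro exI[of _ "z # us"] exI[of _ vs]) simp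
    next
      case (Some b)
      show ?thesis
      \<comment> \<open>A kept element belongs to the left part only while \<open>xs\<close> is
        nonempty; otherwise it opens the right part.\<close>
      proof (cases xs)
        case Nil
        with Cons.prems show ?thesis
          by (intro exI[of _ "[]"] exI[of _ "z # zs"]) simp
      next
        case (Cons x xs')
        with Some Cons.prems Cons.IH[of xs'] obtain us vs where "b = x" "zs = us @ vs"
          "List.map_filter f us = xs'" "List.map_filter f vs = ys"
          by auto
        with Some Cons show ?thesis
          by (intro exI[of _ "z # us"] exI[of _ vs]) simp
      qed
    qed
  qed simp
  with that show thesis by blast
qed

text \<open>Isolates the single move that carries a given activity: everything ahead of it is
  dropped by \<open>f\<close>.\<close>

lemma map_filter_eq_ConsE:
  assumes "List.map_filter f zs = x # xs"
  obtains us z vs where "zs = us @ z # vs" "List.map_filter f us = []" "f z = Some x"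
    "List.map_filter f vs = xs"
proof -
  have "\<exists>us z vs. zs = us @ z # vs \<and> List.map_filter f us = [] \<and> f z = Some x \<and>
      List.map_filter f vs = xs"
    using assms
  proof (induction zs)
    case (Cons z zs)
    show ?case
    proof (cases "f z")
      case None
      with Cons obtain us z' vs where "zs = us @ z' # vs" "List.map_filter f us = []"
        "f z' = Some x" "List.map_filter f vs = xs"
        by auto
      with None show ?thesis
        by (intro exI[of _ "z # us"] exI[of _ z'] exI[of _ vs]) simp
    next
      case (Some b)
      with Cons.prems show ?thesis
        by (intro exI[of _ "[]"] exI[of _ z] exI[of _ zs]) simp
    qed
  qed simp
  with that show thesis by blast
qed

lemma firing_sequence_transitions:
  "firing_sequence N M ts M' \<Longrightarrow> set ts \<subseteq> transitions N"
  by (induction rule: firing_sequence.induct) (auto simp: enabled_def)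

lemma standard_cost_simps [simp]:
  "standard_cost N [] = 0"
  "standard_cost N (m # \<gamma>) = standard_move_cost N m + standard_cost N \<gamma>"
  "standard_cost N (\<gamma> @ \<gamma>') = standard_cost N \<gamma> + standard_cost N \<gamma>'"
  by (simp_all add: standard_cost_def)

text \<open>\<open>None\<close> encodes both the silent label and the missing log component, so
  \<open>(labeling N t, Some t)\<close> is a synchronous move for visible \<open>t\<close> and a
  move in model only for silent \<open>t\<close>. Both are legal and cost 0.\<close>

lemma zero_cost_alignment_visible_trace:
  assumes "set ts \<subseteq> transitions N"
  shows "\<exists>\<gamma>. is_alignment N (List.map_filter (labeling N) ts) ts \<gamma> \<and> standard_cost N \<gamma> = 0"
proof (intro exI conjI)
  let ?\<gamma> = "map (\<lambda>t. (labeling N t, Some t)) ts"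
  have "(labeling N t, Some t) \<in> legal_moves N" if "t \<in> transitions N" for t
    using that by (cases "labeling N t") (auto simp: legal_moves_def)
  with assms have "?\<gamma> \<in> lists (legal_moves N)"
    by (auto simp: subset_iff)
  moreover have "List.map_filter fst ?\<gamma> = List.map_filter (labeling N) ts"
    by (simp add: List.map_filter_def filter_map o_def)
  moreover have "List.map_filter snd ?\<gamma> = ts"
    by (simp add: List.map_filter_def filter_map o_def)
  ultimately show "is_alignment N (List.map_filter (labeling N) ts) ts ?\<gamma>"
    by (simp add: is_alignment_def)
  have "standard_move_cost N (labeling N t, Some t) = 0" for t
    by (cases "labeling N t") auto
  then show "standard_cost N ?\<gamma> = 0"
    by (simp add: standard_cost_def o_def)
qed

text \<open>The alignment is transported backwards along the edit with \<open>ts\<close> fixed, so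
  the new alignment still belongs to the same firing sequence.\<close>

lemma edit_alignment_cost_le:
  assumes "edit \<sigma> \<sigma>'" "is_alignment N \<sigma>' ts \<gamma>"
  shows "\<exists>\<gamma>'. is_alignment N \<sigma> ts \<gamma>' \<and> standard_cost N \<gamma>' \<le> Suc (standard_cost N \<gamma>)"
  using assms(1)
proof cases
  case (deletion xs a ys)
  with assms(2) have "List.map_filter fst \<gamma> = xs @ ys"
    by (simp add: is_alignment_def)
  then obtain \<gamma>\<^sub>1 \<gamma>\<^sub>2 where "\<gamma> = \<gamma>\<^sub>1 @ \<gamma>\<^sub>2" "List.map_filter fst \<gamma>\<^sub>1 = xs" "List.map_filter fst \<gamma>\<^sub>2 = ys"
    by (rule map_filter_eq_appendE)
  with assms(2) deletion show ?thesis
    by (intro exI[of _ "\<gamma>\<^sub>1 @ (Some a, None) # \<gamma>\<^sub>2"])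
      (auto simp: is_alignment_def legal_moves_def map_filter_append)
next
  case (insertion xs ys a)
  with assms(2) have "List.map_filter fst \<gamma> = xs @ a # ys"
    by (simp add: is_alignment_def)
  then obtain \<gamma>\<^sub>1 \<gamma>' where \<gamma>: "\<gamma> = \<gamma>\<^sub>1 @ \<gamma>'" "List.map_filter fst \<gamma>\<^sub>1 = xs"
    and "List.map_filter fst \<gamma>' = a # ys"
    by (rule map_filter_eq_appendE)
  \<comment> \<open>The first split fixes only the log projection, so moves in model only, collected
    in \<open>\<gamma>\<^sub>2\<close>, may precede the move \<open>m\<close> that carries
    \<open>a\<close>.\<close>
  from this(3) obtain \<gamma>\<^sub>2 m \<gamma>\<^sub>3 where \<gamma>': "\<gamma>' = \<gamma>\<^sub>2 @ m # \<gamma>\<^sub>3" "List.map_filter fst \<gamma>\<^sub>2 = []"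
    "fst m = Some a" "List.map_filter fst \<gamma>\<^sub>3 = ys"
    by (rule map_filter_eq_ConsE)
  show ?thesis
  proof (cases "snd m")
    case None
    \<comment> \<open>Here \<open>m\<close> is in log only; dropping it leaves the model projection
      unchanged and saves 1.\<close>
    with \<gamma> \<gamma>' assms(2) insertion show ?thesis
      by (intro exI[of _ "\<gamma>\<^sub>1 @ \<gamma>\<^sub>2 @ \<gamma>\<^sub>3"])
        (auto simp: is_alignment_def map_filter_append)
  next
    case (Some t)
    with \<gamma>'(3) have "m = (Some a, Some t)"
      by (simp add: prod_eq_iff)
    \<comment> \<open>The transition \<open>t\<close> must stay in the model projection, so only the
      activity is removed from \<open>m\<close>; the cost rises from 0 to at most 1.\<close>
    with \<gamma> \<gamma>' assms(2) insertion show ?thesis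
      by (intro exI[of _ "\<gamma>\<^sub>1 @ \<gamma>\<^sub>2 @ (None, Some t) # \<gamma>\<^sub>3"])
        (auto simp: is_alignment_def legal_moves_def map_filter_append)
  qed
qed

lemma relpowp_edit_alignment_cost_le:
  assumes "(edit ^^ n) \<sigma> \<sigma>'" "is_alignment N \<sigma>' ts \<gamma>"
  shows "\<exists>\<gamma>'. is_alignment N \<sigma> ts \<gamma>' \<and> standard_cost N \<gamma>' \<le> standard_cost N \<gamma> + n"
  using assms(1)
proof (induction n arbitrary: \<sigma>)
  case 0
  with assms(2) show ?case by auto
next
  case (Suc n)
  \<comment> \<open>The first edit is split off, not the last: the induction hypothesis carries the
    alignment from \<open>\<sigma>'\<close> back to \<open>\<rho>\<close>, and one more edit reaches
    \<open>\<sigma>\<close>.\<close>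
  from Suc.prems obtain \<rho> where "edit \<sigma> \<rho>" "(edit ^^ n) \<rho> \<sigma>'"
    by (blast dest: relpowp_Suc_D2)
  moreover from Suc.IH[OF this(2)] obtain \<gamma>' where
    "is_alignment N \<rho> ts \<gamma>'" "standard_cost N \<gamma>' \<le> standard_cost N \<gamma> + n"
    by blast
  ultimately show ?case
    by (fastforce dest: edit_alignment_cost_le)
qed

theorem lemma1:
  fixes SN :: "('n, 'a) system_net"
    and \<gamma>\<^sub>S\<^sub>N :: "'a list \<Rightarrow> ('n, 'a) move list"
    and \<sigma>\<^sub>L \<sigma>\<^sub>M :: "'a list"
  assumes "is_system_net SN"
    and "\<And>\<sigma>. optimal_alignment \<sigma> SN (\<gamma>\<^sub>S\<^sub>N \<sigma>)"
    and "\<sigma>\<^sub>M \<in> visible_traces SN"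
  shows "standard_cost SN (\<gamma>\<^sub>S\<^sub>N \<sigma>\<^sub>L) \<le> edit_distance \<sigma>\<^sub>L \<sigma>\<^sub>M"
proof -
  from assms(3) obtain ts where ts: "ts \<in> complete_firing_sequences SN"
    and \<sigma>\<^sub>M: "\<sigma>\<^sub>M = List.map_filter (labeling SN) ts"
    by (auto simp: visible_traces_def)
  from ts have "set ts \<subseteq> transitions SN"
    by (auto simp: complete_firing_sequences_def dest: firing_sequence_transitions)
  then obtain \<gamma> where \<gamma>: "is_alignment SN \<sigma>\<^sub>M ts \<gamma>" "standard_cost SN \<gamma> = 0"
    using zero_cost_alignment_visible_trace \<sigma>\<^sub>M by blast
  \<comment> \<open>Starting from cost 0, a shortest chain of edits yields an alignment of the log
    trace whose cost is at most the length of the chain.\<close>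
  from relpowp_edit_alignment_cost_le[OF edit_distance_attained \<gamma>(1)] \<gamma>(2)
  obtain \<gamma>' where \<gamma>': "is_alignment SN \<sigma>\<^sub>L ts \<gamma>'"
    and cost: "standard_cost SN \<gamma>' \<le> edit_distance \<sigma>\<^sub>L \<sigma>\<^sub>M"
    by auto
  \<comment> \<open>Since \<open>ts\<close> is still a complete firing sequence,
    \<open>\<gamma>'\<close> competes with the optimal alignment.\<close>
  from \<gamma>' ts have "\<gamma>' \<in> alignments \<sigma>\<^sub>L SN"
    by (auto simp: alignments_def)
  with assms(2) have "standard_cost SN (\<gamma>\<^sub>S\<^sub>N \<sigma>\<^sub>L) \<le> standard_cost SN \<gamma>'"
    by (auto simp: optimal_alignment_def)
  with cost show ?thesis by simp
qed

end
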